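(* Let $m_1,\dots,m_n\in\mathbb{R}$ with $m_2,\dots,m_n>0$, $m_1<0$ and $-m_1>m_2+\cdots+m_n$. Then for any initial positions $x_1(0),\dots,x_n(0)\in\mathbb{R}^2$ that are pairwise distinct, the solution of the point vortex ODE with masses $m_1,\dots,m_n$ exists for all time $t\ge 0$ and is bounded for all time, i.e. $\sup_{t\ge 0}\max_{1\le i\le n}|x_i(t)|<\infty$.
   Context: The point vortex ODE with nonzero real masses $m_1,\dots,m_n$ is the system for $x_i(t)\in\mathbb{R}^2$, $$\frac{d}{dt}x_i(t)=\sum_{j\neq i} m_j K(x_i(t),x_j(t)),\qquad K(x,y)=\frac{(x-y)^\perp}{|x-y|^2},\qquad (z_1,z_2)^\perp=(-z_2,z_1).$$ A solution on a time interval is required to have $x_i(t)\neq x_j(t)$ for all $i\neq j$ and all $t$ in the interval. *)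

theory Defs
  imports "HOL-Analysis.Analysis"
begin

definition perp :: "real^2 \<Rightarrow> real^2" where
  "perp z = vector [- (z $ 2), z $ 1]"

definition vortex_kernel :: "real^2 \<Rightarrow> real^2 \<Rightarrow> real^2" where
  "vortex_kernel x y = (1 / (norm (x - y))\<^sup>2) *\<^sub>R perp (x - y)"

text \<open>
  Vortices are indexed by 1, ..., n; the values of m and of x t outside this range
  are irrelevant. The derivative is taken relative to J, hence it is one-sided at an
  endpoint belonging to J.
\<close>

definition point_vortex_solution ::
  "nat \<Rightarrow> (nat \<Rightarrow> real) \<Rightarrow> real set \<Rightarrow> (real \<Rightarrow> nat \<Rightarrow> real^2) \<Rightarrow> bool" where
  "point_vortex_solution n m J x \<longleftrightarrow>
     (\<forall>t\<in>J. (\<forall>i\<in>{1..n}. \<forall>j\<in>{1..n}. i \<noteq> j \<longrightarrow> x t i \<noteq> x t j) \<and>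
       (\<forall>i\<in>{1..n}.
         ((\<lambda>s. x s i) has_vector_derivative
            (\<Sum>j\<in>{1..n} - {i}. m j *\<^sub>R vortex_kernel (x t i) (x t j))) (at t within J)))"

end

theory Submission
  imports Defs "HOL-Probability.Discrete_Topology"
begin

text \<open>
  One family of quadratic forms carries the proof. For a set \<open>P\<close> of vortices consider
  \<open>L\<^sub>P = (\<Sum>i\<in>P. \<Sum>j\<in>P. m\<^sub>i m\<^sub>j |x\<^sub>i - x\<^sub>j|\<^sup>2)\<close> (\<open>pair_form\<close>). The kernel is odd and
  orthogonal to its argument, so the interactions inside \<open>P\<close> do not change \<open>L\<^sub>P\<close>. An outside
  vortex at distance at least \<open>r\<close> from \<open>P\<close> moves the members of \<open>P\<close> with almost equal
  velocities, the differences being at most a constant times \<open>|x\<^sub>i - x\<^sub>j| / r\<^sup>2\<close>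
  (\<open>abs_pair_form_rate_le\<close>). The hypothesis on the masses makes \<open>L\<^sub>P\<close>, up to a sign that
  depends only on whether \<open>P\<close> contains the negative vortex, comparable to the positive form
  with weights \<open>|m\<^sub>i| |m\<^sub>j|\<close>, hence to the squared diameter of \<open>P\<close>
  (\<open>pair_form_coercive\<close>). So \<open>|L\<^sub>P|\<close> obeys a linear differential
  inequality as long as the rest stays away from \<open>P\<close>.

  Boundedness is the case of all vortices: there is no outside, \<open>L\<close> is conserved, mutual
  distances are bounded, and the conserved centre of vorticity (the total mass is negative, in
  particular nonzero) bounds the positions.

  Collisions are excluded on every interval \<open>[0, T]\<close> by downward induction on the size of the
  cluster. Suppose that every cluster of \<open>k + 1\<close> vortices has diameter at least \<open>d'\<close>. When a
  cluster \<open>P\<close> of \<open>k\<close> vortices has diameter below \<open>d' / 2\<close>, each further vortex is at distance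
  at least \<open>d' / 2\<close> from every member of \<open>P\<close>; so \<open>|L\<^sub>P|\<close> decays at most exponentially while it
  is small, and the diameter of \<open>P\<close> has a positive lower bound on \<open>[0, T]\<close>
  (\<open>clusters_spread_step\<close>). Pairs are the clusters of size two.

  For existence, the kernel is made globally Lipschitz by replacing \<open>|z|\<^sup>2\<close> in its denominator
  by \<open>(max |z| e)\<^sup>2\<close>. This keeps oddness and orthogonality, and all the bounds above hold with
  constants independent of \<open>e\<close>. Given \<open>T\<close>, choose \<open>e\<close> to be the lower bound on the mutual distances:
  then the global solution of the regularised system never sees the regularisation on \<open>[0, T]\<close>
  and solves the point vortex system there. The same bound reduces uniqueness to the Lipschitz
  case, and uniqueness makes the solutions for different \<open>T\<close> fit together.
\<close>

section \<open>The regularised kernel\<close>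

lemma perp_nth: "perp z $ 1 = - (z $ 2)" "perp z $ 2 = z $ 1"
  by (simp_all add: perp_def vector_2)

lemma bounded_linear_perp: "bounded_linear perp"
  unfolding linear_conv_bounded_linear[symmetric]
  by (rule linearI) (simp_all add: vec_eq_iff forall_2 perp_nth)

lemma norm_perp [simp]: "norm (perp z) = norm z"
  by (simp add: norm_vec_def L2_set_def sum_2 perp_nth add.commute)

lemma inner_perp_self [simp]: "z \<bullet> perp z = 0"
  by (simp add: inner_vec_def sum_2 perp_nth)

text \<open>
  The vortex blob kernel: a rigid rotation within distance \<open>e\<close> replaces the singularity, and the kernel
  stays odd and orthogonal to its argument. For \<open>e = 0\<close> it is the point vortex kernel.
\<close>

definition blob_kernel :: "real \<Rightarrow> real^2 \<Rightarrow> real^2" where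
  "blob_kernel e z = (1 / (max (norm z) e)\<^sup>2) *\<^sub>R perp z"

lemma blob_kernel_minus: "blob_kernel e (- z) = - blob_kernel e z"
  by (simp add: blob_kernel_def linear_neg[OF bounded_linear.linear[OF bounded_linear_perp]])

lemma blob_kernel_diff_swap: "blob_kernel e (x - y) = - blob_kernel e (y - x)"
  using blob_kernel_minus[of e "y - x"] by simp

lemma inner_blob_kernel_self: "z \<bullet> blob_kernel e z = 0"
  by (simp add: blob_kernel_def)

lemma blob_kernel_0 [simp]: "blob_kernel e 0 = 0"
  by (simp add: blob_kernel_def linear_0[OF bounded_linear.linear[OF bounded_linear_perp]])

lemma blob_kernel_eq_vortex_kernel:
  assumes "e \<le> norm (x - y)"
  shows "blob_kernel e (x - y) = vortex_kernel x y"
  using assms by (simp add: blob_kernel_def vortex_kernel_def max_def)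

text \<open>
  With \<open>r = e\<close> this is the global Lipschitz bound of the regularised kernel. With \<open>r\<close> a lower bound
  for the two distances it is a bound independent of \<open>e\<close>, as the estimates for clusters require.
\<close>

lemma blob_kernel_lipschitz:
  assumes "r > 0" "r \<le> max (norm z) e" "r \<le> max (norm w) e"
  shows "norm (blob_kernel e z - blob_kernel e w) \<le> 3 / r\<^sup>2 * norm (z - w)"
proof -
  define a where "a = max (norm z) e"
  define b where "b = max (norm w) e"
  have pos: "a > 0" "b > 0" "r \<le> a" "r \<le> b" using assms by (auto simp: a_def b_def)
  have wb: "norm w \<le> b" by (simp add: b_def)
  have ab: "\<bar>b - a\<bar> \<le> norm (z - w)"
  proof -
    have "\<bar>b - a\<bar> \<le> \<bar>norm w - norm z\<bar>" unfolding a_def b_def by (auto simp: max_def)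
    also have "\<dots> \<le> norm (z - w)" using norm_triangle_ineq3[of w z] by (simp add: norm_minus_commute)
    finally show ?thesis .
  qed
  have "blob_kernel e z - blob_kernel e w = perp ((1/a\<^sup>2) *\<^sub>R z - (1/b\<^sup>2) *\<^sub>R w)"
    unfolding blob_kernel_def a_def b_def
    by (simp add: linear_diff[OF bounded_linear.linear[OF bounded_linear_perp]]
        linear_scale[OF bounded_linear.linear[OF bounded_linear_perp]])
  also have "(1/a\<^sup>2) *\<^sub>R z - (1/b\<^sup>2) *\<^sub>R w = (1/a\<^sup>2) *\<^sub>R (z - w) + (1/a\<^sup>2 - 1/b\<^sup>2) *\<^sub>R w"
    by (simp add: algebra_simps)
  finally have "norm (blob_kernel e z - blob_kernel e w)
      \<le> (1/a\<^sup>2) * norm (z - w) + \<bar>1/a\<^sup>2 - 1/b\<^sup>2\<bar> * norm w"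
    by (simp add: norm_triangle_le)
  also have "\<bar>1/a\<^sup>2 - 1/b\<^sup>2\<bar> * norm w \<le> \<bar>1/a\<^sup>2 - 1/b\<^sup>2\<bar> * b"
    using wb by (simp add: mult_left_mono)
  also have "\<bar>1/a\<^sup>2 - 1/b\<^sup>2\<bar> * b = \<bar>b - a\<bar> * (1/a\<^sup>2 + 1/(a*b))"
  proof -
    have "1/a\<^sup>2 - 1/b\<^sup>2 = (b - a) * ((b + a) / (a\<^sup>2 * b\<^sup>2))"
      using pos by (simp add: field_simps power2_eq_square)
    then have "\<bar>1/a\<^sup>2 - 1/b\<^sup>2\<bar> = \<bar>b - a\<bar> * ((b + a) / (a\<^sup>2 * b\<^sup>2))"
      using pos by (simp add: abs_mult)
    then show ?thesis using pos by (simp add: field_simps power2_eq_square)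
  qed
  also have "\<dots> \<le> norm (z - w) * (1/a\<^sup>2 + 1/(a*b))"
    using ab pos by (intro mult_right_mono) auto
  finally have "norm (blob_kernel e z - blob_kernel e w)
      \<le> (2/a\<^sup>2 + 1/(a*b)) * norm (z - w)" by (simp add: algebra_simps)
  also have "\<dots> \<le> (3 / r\<^sup>2) * norm (z - w)"
  proof (rule mult_right_mono)
    have "2/a\<^sup>2 \<le> 2/r\<^sup>2" using pos assms(1) by (intro divide_left_mono power_mono) auto
    moreover have "1/(a*b) \<le> 1/(r*r)"
      using pos assms(1) by (intro divide_left_mono mult_mono) auto
    ultimately show "2/a\<^sup>2 + 1/(a*b) \<le> 3/r\<^sup>2" by (simp add: power2_eq_square)
  qed simp
  finally show ?thesis .
qed

section \<open>Two scalar differential inequalities\<close>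

text \<open>
  Decay at rate at most \<open>C\<close> is assumed only below the level \<open>d\<close>. It suffices to look back from \<open>t\<close> to
  the last time at which \<open>f\<close> was at least \<open>d\<close>: from then on \<open>exp (C t) f t\<close> is nondecreasing.
\<close>

lemma barrier_lower_bound:
  fixes f f' :: "real \<Rightarrow> real"
  assumes der: "\<And>t. t \<in> {0..T} \<Longrightarrow> (f has_real_derivative f' t) (at t within {0..T})"
    and low: "\<And>t. t \<in> {0..T} \<Longrightarrow> f t < d \<Longrightarrow> f' t \<ge> - C * f t"
    and "C \<ge> 0" "d > 0" "d \<le> f 0" and t: "t \<in> {0..T}"
  shows "f t \<ge> d * exp (- C * t)"
proof (rule ccontr)
  assume "\<not> ?thesis"
  then have ft: "f t < d * exp (- C * t)" by simp
  also have "d * exp (- C * t) \<le> d" using t \<open>C \<ge> 0\<close> \<open>d > 0\<close> by simp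
  finally have ftd: "f t < d" .
  have cont: "continuous_on {0..T} f"
    by (rule DERIV_continuous_on[OF der])
  define S where "S = {0..t} \<inter> f -` {d..}"
  have "closed S" unfolding S_def
    by (rule continuous_closed_preimage) (use cont t in \<open>auto intro: continuous_on_subset\<close>)
  then have "compact S"
    unfolding compact_eq_bounded_closed S_def by (simp add: bounded_Int)
  moreover have "0 \<in> S" using t \<open>d \<le> f 0\<close> by (simp add: S_def)
  ultimately obtain s where s: "s \<in> S" "\<And>u. u \<in> S \<Longrightarrow> u \<le> s"
    using compact_attains_sup[of S] by auto
  have st: "0 \<le> s" "s < t" "d \<le> f s" using s(1) ftd unfolding S_def
    by (auto simp: less_le)
  have below: "f u < d" if "s < u" "u \<le> t" for u
    using s(2)[of u] that st by (fastforce simp: S_def not_le)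
  define g where "g = (\<lambda>u. exp (C * u) * f u)"
  have "\<exists>x\<in>{s<..<t}. g t - g s = (\<lambda>h. h * (exp (C * x) * (C * f x + f' x))) (t - s)"
  proof (rule mvt_simple[OF \<open>s < t\<close>])
    fix x assume "s \<le> x" "x \<le> t"
    then have "(f has_real_derivative f' x) (at x within {s..t})"
      using der[of x] st t by (auto intro: DERIV_subset)
    then show "(g has_derivative (\<lambda>h. h * (exp (C * x) * (C * f x + f' x)))) (at x within {s..t})"
      unfolding g_def has_field_derivative_def[symmetric]
      by (auto intro!: derivative_eq_intros simp: has_field_derivative_def[symmetric] mult_commute_abs algebra_simps)
  qed
  then obtain x where x: "s < x" "x < t" "g t - g s = (t - s) * (exp (C * x) * (C * f x + f' x))"
    by auto
  have "C * f x + f' x \<ge> 0" using low[of x] below[of x] x st t by auto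
  then have "0 \<le> (t - s) * (exp (C * x) * (C * f x + f' x))" using x by simp
  then have "g s \<le> g t" using x by linarith
  moreover have "d \<le> g s"
  proof -
    have "1 * d \<le> exp (C * s) * f s" using st \<open>C \<ge> 0\<close> \<open>d > 0\<close> by (intro mult_mono) auto
    then show ?thesis by (simp add: g_def)
  qed
  moreover have "g t < d" using ft by (simp add: g_def exp_minus field_simps)
  ultimately show False by simp
qed

lemma gronwall_zero:
  fixes f f' :: "real \<Rightarrow> real"
  assumes der: "\<And>t. t \<in> {0..T} \<Longrightarrow> (f has_real_derivative f' t) (at t within {0..T})"
    and le: "\<And>t. t \<in> {0..T} \<Longrightarrow> f' t \<le> C * f t"
    and "f 0 = 0" and t: "t \<in> {0..T}"
  shows "f t \<le> 0"
proof (cases "t = 0")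
  case False
  define g where "g = (\<lambda>u. exp (- C * u) * f u)"
  have "\<exists>x\<in>{0<..<t}. g t - g 0 = (\<lambda>h. (exp (- C * x) * (f' x - C * f x)) * h) (t - 0)"
  proof (rule mvt_simple)
    show "0 < t" using t False by simp
    fix x assume "0 \<le> x" "x \<le> t"
    then have "(f has_real_derivative f' x) (at x within {0..t})"
      using der[of x] t by (auto intro: DERIV_subset)
    then show "(g has_derivative (\<lambda>h. (exp (- C * x) * (f' x - C * f x)) * h)) (at x within {0..t})"
      unfolding g_def has_field_derivative_def[symmetric]
      by (auto intro!: derivative_eq_intros simp: algebra_simps)
  qed
  then obtain x where x: "0 < x" "x < t" "g t - g 0 = exp (- C * x) * (f' x - C * f x) * t" by auto
  have "f' x - C * f x \<le> 0" using le[of x] x t by auto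
  then have "exp (- C * x) * (f' x - C * f x) * t \<le> 0"
    using t by (simp add: mult_nonneg_nonpos mult_nonpos_nonneg)
  then have "g t \<le> 0" using x \<open>f 0 = 0\<close> by (simp add: g_def)
  then show ?thesis by (simp add: g_def mult_le_0_iff)
qed (use assms in simp)

section \<open>Global solutions of Lipschitz equations\<close>

text \<open>
  The weight turns the Picard operator into a contraction on the whole half-line at once: growth
  \<open>exp (2 L s)\<close> is reproduced under the integral with the factor \<open>1 / (2 L)\<close>.
\<close>

lemma exp_weight_integral_bound:
  fixes g :: "real \<Rightarrow> 'a::banach"
  assumes "L > 0" "t \<ge> 0" "continuous_on {0..t} g"
    and le: "\<And>s. s \<in> {0..t} \<Longrightarrow> norm (g s) \<le> c * exp (2 * L * s)"
  shows "exp (- (2 * L * t)) * norm (integral {0..t} g) \<le> c / (2 * L)"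
proof -
  have "c \<ge> 0" using order_trans[OF norm_ge_zero le[of 0]] assms by simp
  have hi: "((\<lambda>s. c * exp (2 * L * s)) has_integral
      (c / (2 * L) * exp (2 * L * t) - c / (2 * L) * exp (2 * L * 0))) {0..t}"
    by (rule fundamental_theorem_of_calculus)
      (use assms in \<open>auto intro!: derivative_eq_intros
         simp: has_real_derivative_iff_has_vector_derivative[symmetric]\<close>)
  have "norm (integral {0..t} g) \<le> integral {0..t} (\<lambda>s. c * exp (2 * L * s))"
    by (rule Henstock_Kurzweil_Integration.integral_norm_bound_integral)
      (use assms hi in \<open>auto intro: integrable_continuous_real\<close>)
  also have "\<dots> \<le> c / (2 * L) * exp (2 * L * t)"
    using integral_unique[OF hi] \<open>c \<ge> 0\<close> \<open>L > 0\<close> by simp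
  finally have "exp (- (2 * L * t)) * norm (integral {0..t} g)
      \<le> exp (- (2 * L * t)) * (c / (2 * L) * exp (2 * L * t))"
    by (rule mult_left_mono) simp
  also have "\<dots> = c / (2 * L)" using exp_minus_inverse[of "2 * L * t"] by (simp add: mult_ac)
  finally show ?thesis .
qed

lemma integral_has_vector_derivative_ray:
  fixes g :: "real \<Rightarrow> 'a::banach"
  assumes "continuous_on {0..} g" "t \<ge> 0"
  shows "((\<lambda>u. integral {0..u} g) has_vector_derivative g t) (at t within {0..})"
proof -
  have "((\<lambda>u. integral {0..u} g) has_vector_derivative g t) (at t within {0..t+1})"
    by (rule Henstock_Kurzweil_Integration.integral_has_vector_derivative)
      (use assms in \<open>auto intro: continuous_on_subset\<close>)
  moreover have "at t within {0..t+1} = at t within {0..}"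
    by (rule at_within_nhd[of _ "{..<t+1}"]) (use assms in auto)
  ultimately show ?thesis by simp
qed

text \<open>
  The unknown is \<open>u t = exp (- 2 L t) x t\<close>, which is bounded since \<open>F\<close> grows at most linearly. For
  \<open>u\<close> the integral equation is a fixed point problem in the Banach space of bounded continuous
  functions, and the contraction factor is \<open>1/2\<close>.
\<close>

theorem lipschitz_ode_global_solution:
  fixes F :: "'a::banach \<Rightarrow> 'a"
  assumes "L > 0" and lip: "\<And>x y. norm (F x - F y) \<le> L * norm (x - y)"
  shows "\<exists>x. x 0 = x0 \<and> (\<forall>t\<ge>0. (x has_vector_derivative F (x t)) (at t within {0..}))"
proof -
  have contF: "continuous_on UNIV F"
    by (rule lipschitz_on_continuous_on[of L])
      (use assms in \<open>auto intro!: lipschitz_onI simp: dist_norm\<close>)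
  define g where "g = (\<lambda>(u :: real \<Rightarrow>\<^sub>C 'a) s. F (exp (2 * L * s) *\<^sub>R apply_bcontfun u s))"
  have contu: "continuous_on A (\<lambda>s. apply_bcontfun u s)" for A and u :: "real \<Rightarrow>\<^sub>C 'a"
    using continuous_on_apply_bcontfun continuous_on_subset by blast
  have contg: "continuous_on A (g u)" for A u
    unfolding g_def
    by (rule continuous_on_compose2[OF contF]) (auto intro!: continuous_intros contu)
  \<comment> \<open>\<open>max 0 t\<close> extends functions on the half-line to the real line by their value at \<open>0\<close>.\<close>
  define P where "P = (\<lambda>u t. exp (- (2 * L * max 0 t)) *\<^sub>R (x0 + integral {0..max 0 t} (g u)))"
  have contI: "continuous_on UNIV (\<lambda>t. integral {0..max 0 t} (g u))" for u
  proof -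
    have "continuous_on {0..} (\<lambda>t. integral {0..t} (g u))"
      by (auto simp: continuous_on_eq_continuous_within
          intro!: has_vector_derivative_continuous integral_has_vector_derivative_ray contg)
    then show ?thesis
      by (rule continuous_on_compose2) (auto intro!: continuous_intros)
  qed
  have bcP: "P u \<in> bcontfun" for u
  proof (rule bcontfun_normI)
    show "continuous_on UNIV (P u)" unfolding P_def
      by (intro continuous_intros contI)
    define c where "c = norm (F 0) + L * norm u"
    have gb: "norm (g u s) \<le> c * exp (2 * L * s)" if "s \<ge> 0" for s
    proof -
      have "norm (g u s) \<le> norm (F 0) + norm (g u s - F 0)" by norm
      also have "norm (g u s - F 0) \<le> L * (exp (2 * L * s) * norm u)"
        using lip[of "exp (2 * L * s) *\<^sub>R u s" 0] norm_bounded[of u s] \<open>L > 0\<close>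
        by (auto simp: g_def intro!: order_trans[OF lip] mult_left_mono)
      also have "norm (F 0) \<le> norm (F 0) * exp (2 * L * s)"
        using that \<open>L > 0\<close> by (simp add: mult_le_cancel_left1)
      finally show ?thesis by (simp add: c_def algebra_simps)
    qed
    fix t
    have "norm (P u t) \<le> exp (- (2 * L * max 0 t)) * norm x0
        + exp (- (2 * L * max 0 t)) * norm (integral {0..max 0 t} (g u))"
      unfolding P_def norm_scaleR distrib_left[symmetric]
      by (simp add: norm_triangle_ineq)
    also have "exp (- (2 * L * max 0 t)) * norm x0 \<le> norm x0"
      using \<open>L > 0\<close> by (intro mult_left_le_one_le) auto
    also have "exp (- (2 * L * max 0 t)) * norm (integral {0..max 0 t} (g u)) \<le> c / (2 * L)"
      by (intro exp_weight_integral_bound contg) (use gb \<open>L > 0\<close> in auto)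
    finally show "norm (P u t) \<le> norm x0 + c / (2 * L)" by simp
  qed
  define Phi where "Phi = (\<lambda>u. Bcontfun (P u))"
  have Phi: "apply_bcontfun (Phi u) t = P u t" for u t
    by (simp add: Phi_def Bcontfun_inverse[OF bcP])
  have "\<exists>!u. Phi u = u"
  proof (rule banach_fix_type)
    show "0 \<le> (1/2 :: real)" "(1/2 :: real) < 1" by simp_all
    show "\<forall>u v. dist (Phi u) (Phi v) \<le> 1/2 * dist u v"
    proof (intro allI)
      fix u v
      have "dist (Phi u t) (Phi v t) \<le> 1/2 * dist u v" for t
      proof -
        define s where "s = max 0 t"
        have "s \<ge> 0" by (simp add: s_def)
        have "Phi u t - Phi v t = exp (- (2 * L * s)) *\<^sub>R integral {0..s} (\<lambda>r. g u r - g v r)"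
          unfolding Phi P_def s_def[symmetric]
          by (subst integral_diff) (auto intro!: integrable_continuous_real contg simp: algebra_simps)
        then have "dist (Phi u t) (Phi v t)
            = exp (- (2 * L * s)) * norm (integral {0..s} (\<lambda>r. g u r - g v r))"
          by (simp add: dist_norm)
        also have "\<dots> \<le> (L * dist u v) / (2 * L)"
        proof (rule exp_weight_integral_bound)
          fix r
          have "norm (g u r - g v r) \<le> L * norm (exp (2*L*r) *\<^sub>R u r - exp (2*L*r) *\<^sub>R v r)"
            unfolding g_def by (rule lip)
          also have "\<dots> = L * (exp (2*L*r) * dist (u r) (v r))"
            by (simp add: dist_norm scaleR_diff_right[symmetric])
          also have "\<dots> \<le> L * (exp (2*L*r) * dist u v)"
            using \<open>L > 0\<close> by (intro mult_left_mono dist_bounded) auto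
          finally show "norm (g u r - g v r) \<le> L * dist u v * exp (2 * L * r)"
            by (simp add: mult_ac)
        qed (use \<open>L > 0\<close> \<open>s \<ge> 0\<close> in \<open>auto intro!: continuous_intros contg\<close>)
        finally show ?thesis using \<open>L > 0\<close> by simp
      qed
      then show "dist (Phi u) (Phi v) \<le> 1/2 * dist u v" by (rule dist_bound)
    qed
  qed
  then obtain u where u: "Phi u = u" by auto
  define x where "x = (\<lambda>t. x0 + integral {0..t} (g u))"
  have gx: "g u t = F (x t)" if "t \<ge> 0" for t
  proof -
    have "u t = exp (- (2 * L * t)) *\<^sub>R x t"
      using Phi[of u t] u that by (simp add: P_def x_def max_def)
    then show ?thesis by (simp add: g_def exp_add[symmetric])
  qed
  have "(x has_vector_derivative F (x t)) (at t within {0..})" if "t \<ge> 0" for t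
    using integral_has_vector_derivative_ray[OF contg that, of u] gx[OF that]
    unfolding x_def by (auto intro!: derivative_eq_intros)
  moreover have "x 0 = x0" by (simp add: x_def)
  ultimately show ?thesis by blast
qed

section \<open>The regularised vortex flow\<close>

text \<open>
  The sum includes \<open>j = i\<close>, whose term vanishes; without the exclusion the double sums below are
  symmetric under exchange of indices.
\<close>

definition blob_velocity ::
  "nat \<Rightarrow> (nat \<Rightarrow> real) \<Rightarrow> real \<Rightarrow> (nat \<Rightarrow> real^2) \<Rightarrow> nat \<Rightarrow> real^2" where
  "blob_velocity n m e X i = (\<Sum>j\<in>{1..n}. m j *\<^sub>R blob_kernel e (X i - X j))"

definition blob_solution ::
  "nat \<Rightarrow> (nat \<Rightarrow> real) \<Rightarrow> real \<Rightarrow> real set \<Rightarrow> (real \<Rightarrow> nat \<Rightarrow> real^2) \<Rightarrow> bool" where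
  "blob_solution n m e J x \<longleftrightarrow>
     (\<forall>t\<in>J. \<forall>i\<in>{1..n}.
        ((\<lambda>s. x s i) has_vector_derivative blob_velocity n m e (x t) i) (at t within J))"

lemma blob_solution_subset:
  assumes "blob_solution n m e J x" "K \<subseteq> J"
  shows "blob_solution n m e K x"
  using assms by (auto simp: blob_solution_def intro: has_vector_derivative_within_subset)

lemma point_vortex_solution_subset:
  assumes "point_vortex_solution n m J x" "K \<subseteq> J"
  shows "point_vortex_solution n m K x"
  using assms unfolding point_vortex_solution_def
  by (blast intro: has_vector_derivative_within_subset)

lemma blob_velocity_eq_vortex_velocity:
  assumes "i \<in> {1..n}" and far: "\<And>j. j \<in> {1..n} \<Longrightarrow> i \<noteq> j \<Longrightarrow> e \<le> norm (X i - X j)"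
  shows "blob_velocity n m e X i = (\<Sum>j\<in>{1..n} - {i}. m j *\<^sub>R vortex_kernel (X i) (X j))"
proof -
  have "blob_velocity n m e X i = (\<Sum>j\<in>{1..n} - {i}. m j *\<^sub>R blob_kernel e (X i - X j))"
    unfolding blob_velocity_def using assms(1) by (subst sum.remove[of _ i]) auto
  also have "\<dots> = (\<Sum>j\<in>{1..n} - {i}. m j *\<^sub>R vortex_kernel (X i) (X j))"
    by (intro sum.cong) (use far in \<open>auto simp: blob_kernel_eq_vortex_kernel\<close>)
  finally show ?thesis .
qed

text \<open>
  The regularisation is invisible while mutual distances stay at least \<open>e\<close>. The second hypothesis
  makes the equivalence available for \<open>e = 0\<close> too.
\<close>

lemma point_vortex_solution_iff_blob_solution:
  assumes "\<And>t i j. \<lbrakk>t \<in> J; i \<in> {1..n}; j \<in> {1..n}; i \<noteq> j\<rbrakk> \<Longrightarrow> e \<le> norm (x t i - x t j)"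
    and "\<And>t i j. \<lbrakk>t \<in> J; i \<in> {1..n}; j \<in> {1..n}; i \<noteq> j\<rbrakk> \<Longrightarrow> x t i \<noteq> x t j"
  shows "point_vortex_solution n m J x \<longleftrightarrow> blob_solution n m e J x"
proof -
  have "blob_velocity n m e (x t) i = (\<Sum>j\<in>{1..n} - {i}. m j *\<^sub>R vortex_kernel (x t i) (x t j))"
    if "t \<in> J" "i \<in> {1..n}" for t i
    by (rule blob_velocity_eq_vortex_velocity) (use assms(1) that in auto)
  then show ?thesis
    unfolding point_vortex_solution_def blob_solution_def using assms(2) by simp
qed

lemma has_real_derivative_norm_square:
  fixes f :: "real \<Rightarrow> 'a::real_inner"
  assumes "(f has_vector_derivative v) (at t within S)"
  shows "((\<lambda>s. (norm (f s))\<^sup>2) has_real_derivative 2 * (f t \<bullet> v)) (at t within S)"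
  unfolding has_field_derivative_def power2_norm_eq_inner
  by (rule has_derivative_eq_rhs[OF has_derivative_inner])
    (use assms in \<open>auto simp: has_vector_derivative_def inner_commute fun_eq_iff\<close>)

text \<open>
  Gronwall's inequality for the squared distance of the two configurations.
\<close>

lemma blob_solution_unique:
  assumes "e > 0" and sol: "blob_solution n m e {0..T} x" "blob_solution n m e {0..T} y"
    and init: "\<And>i. i \<in> {1..n} \<Longrightarrow> x 0 i = y 0 i"
    and t: "t \<in> {0..T}" and i: "i \<in> {1..n}"
  shows "x t i = y t i"
proof -
  define E where "E = (\<lambda>s. \<Sum>i\<in>{1..n}. (norm (x s i - y s i))\<^sup>2)"
  define E' where "E' = (\<lambda>s. \<Sum>i\<in>{1..n}. 2 * ((x s i - y s i) \<bullet>
     (blob_velocity n m e (x s) i - blob_velocity n m e (y s) i)))"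
  define K where "K = 3 / e\<^sup>2"
  define W where "W = (\<Sum>j\<in>{1..n}. \<bar>m j\<bar>)"
  have "K \<ge> 0" by (simp add: K_def)
  have comp: "(norm (x s j - y s j))\<^sup>2 \<le> E s" if "j \<in> {1..n}" for s j
    unfolding E_def using that by (intro member_le_sum) auto
  have "E t \<le> 0"
  proof (rule gronwall_zero[where f = E and t = t and T = T and f' = E' and C = "real n * (4 * K * W)"])
    fix s assume s: "s \<in> {0..T}"
    show "(E has_real_derivative E' s) (at s within {0..T})"
      unfolding E_def E'_def
    proof (intro DERIV_sum)
      fix i assume "i \<in> {1..n}"
      then have "((\<lambda>s. x s i - y s i) has_vector_derivative
        (blob_velocity n m e (x s) i - blob_velocity n m e (y s) i)) (at s within {0..T})"
        using sol s by (intro has_vector_derivative_diff) (auto simp: blob_solution_def)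
      then show "((\<lambda>s. (norm (x s i - y s i))\<^sup>2) has_real_derivative
          2 * ((x s i - y s i) \<bullet> (blob_velocity n m e (x s) i - blob_velocity n m e (y s) i)))
          (at s within {0..T})"
        by (rule has_real_derivative_norm_square)
    qed
    have "2 * ((x s i - y s i) \<bullet> (blob_velocity n m e (x s) i - blob_velocity n m e (y s) i))
        \<le> 4 * K * W * E s" if i: "i \<in> {1..n}" for i
    proof -
      define a where "a = norm (x s i - y s i)"
      have "blob_velocity n m e (x s) i - blob_velocity n m e (y s) i
        = (\<Sum>j\<in>{1..n}. m j *\<^sub>R (blob_kernel e (x s i - x s j) - blob_kernel e (y s i - y s j)))"
        by (simp add: blob_velocity_def sum_subtractf scaleR_diff_right)
      then have "2 * ((x s i - y s i) \<bullet> (blob_velocity n m e (x s) i - blob_velocity n m e (y s) i))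
        = (\<Sum>j\<in>{1..n}. m j * (2 * ((x s i - y s i) \<bullet> (blob_kernel e (x s i - x s j) - blob_kernel e (y s i - y s j)))))"
        by (simp add: inner_sum_right sum_distrib_left mult_ac)
      also have "\<dots> \<le> (\<Sum>j\<in>{1..n}. \<bar>m j\<bar> * (4 * K * E s))"
      proof (rule sum_mono)
        fix j assume j: "j \<in> {1..n}"
        define b where "b = norm (x s j - y s j)"
        have "norm (blob_kernel e (x s i - x s j) - blob_kernel e (y s i - y s j))
            \<le> K * norm ((x s i - x s j) - (y s i - y s j))"
          unfolding K_def by (rule blob_kernel_lipschitz) (use \<open>e > 0\<close> in auto)
        also have "(x s i - x s j) - (y s i - y s j) = (x s i - y s i) - (x s j - y s j)" by simp
        also have "norm \<dots> \<le> a + b" unfolding a_def b_def by (rule norm_triangle_ineq4)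
        finally have kb: "norm (blob_kernel e (x s i - x s j) - blob_kernel e (y s i - y s j)) \<le> K * (a + b)"
          using \<open>K \<ge> 0\<close> by (simp add: mult_left_mono)
        have "\<bar>(x s i - y s i) \<bullet> (blob_kernel e (x s i - x s j) - blob_kernel e (y s i - y s j))\<bar>
           \<le> a * (K * (a + b))"
          unfolding a_def by (rule order_trans[OF Cauchy_Schwarz_ineq2 mult_left_mono[OF kb[unfolded a_def]]]) simp
        moreover have "2 * (a * (K * (a + b))) \<le> 4 * K * E s"
        proof -
          have "2 * (a * b) \<le> a\<^sup>2 + b\<^sup>2" using sum_squares_bound[of a b] by simp
          moreover have "a\<^sup>2 \<le> E s" "b\<^sup>2 \<le> E s" using comp i j by (auto simp: a_def b_def)
          ultimately have "2 * (a * (a + b)) \<le> 4 * E s" by (simp add: power2_eq_square algebra_simps)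
          then have "K * (2 * (a * (a + b))) \<le> K * (4 * E s)" using \<open>K \<ge> 0\<close> by (rule mult_left_mono)
          then show ?thesis by (simp add: mult_ac)
        qed
        ultimately have q: "\<bar>2 * ((x s i - y s i) \<bullet> (blob_kernel e (x s i - x s j) - blob_kernel e (y s i - y s j)))\<bar>
           \<le> 4 * K * E s" by (simp only: abs_mult)
        have "m j * (2 * ((x s i - y s i) \<bullet> (blob_kernel e (x s i - x s j) - blob_kernel e (y s i - y s j))))
          \<le> \<bar>m j\<bar> * \<bar>2 * ((x s i - y s i) \<bullet> (blob_kernel e (x s i - x s j) - blob_kernel e (y s i - y s j)))\<bar>"
          by (metis abs_ge_self abs_mult)
        also have "\<dots> \<le> \<bar>m j\<bar> * (4 * K * E s)" by (rule mult_left_mono[OF q]) simp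
        finally show "m j * (2 * ((x s i - y s i) \<bullet> (blob_kernel e (x s i - x s j) - blob_kernel e (y s i - y s j))))
          \<le> \<bar>m j\<bar> * (4 * K * E s)" .
      qed
      also have "\<dots> = 4 * K * W * E s" by (simp add: W_def sum_distrib_right mult_ac sum_distrib_left)
      finally show ?thesis .
    qed
    then have "E' s \<le> (\<Sum>i\<in>{1..n}. 4 * K * W * E s)" unfolding E'_def by (rule sum_mono)
    then show "E' s \<le> real n * (4 * K * W) * E s" by simp
  qed (use init t in \<open>auto simp: E_def\<close>)
  then have "(norm (x t i - y t i))\<^sup>2 \<le> 0" using comp[OF i, of t] by linarith
  then show ?thesis by simp
qed

instance bcontfun :: (metric_space, banach) banach ..

lemma bounded_linear_apply_bcontfun:
  "bounded_linear (\<lambda>u :: 'b::topological_space \<Rightarrow>\<^sub>C 'a::real_normed_vector. apply_bcontfun u i)"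
  by (rule bounded_linear_intro[where K = 1]) (auto simp: norm_bounded)

text \<open>
  The state space consists of the bounded functions on a discrete copy of the index set, where every
  function is continuous; this is one Banach space for all \<open>n\<close>. Configurations are extended by
  zero outside \<open>{1..n}\<close>, which gives a vector field that is globally Lipschitz there.
\<close>

lemma blob_solution_exists:
  assumes "e > 0"
  shows "\<exists>x. blob_solution n m e {0..} x \<and> (\<forall>i\<in>{1..n}. x 0 i = x0 i)"
proof -
  define K where "K = 3 / e\<^sup>2"
  define W where "W = (\<Sum>j\<in>{1..n}. \<bar>m j\<bar>)"
  define L where "L = 2 * K * W + 1"
  have "K \<ge> 0" by (simp add: K_def)
  have "W \<ge> 0" unfolding W_def by (rule sum_nonneg) simp
  have "L > 0" using \<open>K \<ge> 0\<close> \<open>W \<ge> 0\<close> by (simp add: L_def add_nonneg_pos)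
  have trunc: "(\<lambda>k. if of_discrete k \<in> {1..n} then z (of_discrete k) else 0) \<in> bcontfun"
    for z :: "nat \<Rightarrow> real^2"
  proof (rule bcontfun_normI)
    show "norm (if of_discrete k \<in> {1..n} then z (of_discrete k) else 0) \<le> (\<Sum>i\<in>{1..n}. norm (z i))"
      for k :: "nat discrete"
      by (auto intro!: member_le_sum[of _ _ "\<lambda>i. norm (z i)"] sum_nonneg)
  qed (simp add: continuous_on_open_vimage open_discrete)
  define emb :: "(nat \<Rightarrow> real^2) \<Rightarrow> nat discrete \<Rightarrow>\<^sub>C (real^2)"
    where "emb = (\<lambda>z. Bcontfun (\<lambda>k. if of_discrete k \<in> {1..n} then z (of_discrete k) else 0))"
  have emb: "apply_bcontfun (emb z) k = (if of_discrete k \<in> {1..n} then z (of_discrete k) else 0)" for z k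
    by (simp only: emb_def Bcontfun_inverse[OF trunc])
  define pos :: "(nat discrete \<Rightarrow>\<^sub>C (real^2)) \<Rightarrow> nat \<Rightarrow> real^2"
    where "pos = (\<lambda>u i. apply_bcontfun u (discrete i))"
  define F where "F = (\<lambda>u. emb (blob_velocity n m e (pos u)))"
  have lip: "norm (F u - F v) \<le> L * norm (u - v)" for u v
  proof -
    have uv: "norm (pos u i - pos v i) \<le> norm (u - v)" for i
      using dist_bounded[of u "discrete i" v] by (simp add: dist_norm pos_def)
    have "dist (F u k) (F v k) \<le> 2 * K * W * norm (u - v)" for k
    proof (cases "of_discrete k \<in> {1..n}")
      case True
      define i where "i = of_discrete k"
      have "dist (F u k) (F v k) = norm (\<Sum>j\<in>{1..n}. m j *\<^sub>R
          (blob_kernel e (pos u i - pos u j) - blob_kernel e (pos v i - pos v j)))"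
        using True by (simp add: F_def emb dist_norm blob_velocity_def sum_subtractf scaleR_diff_right i_def)
      also have "\<dots> \<le> (\<Sum>j\<in>{1..n}. \<bar>m j\<bar> * (K * (2 * norm (u - v))))"
      proof (intro sum_norm_le)
        fix j
        have "norm (blob_kernel e (pos u i - pos u j) - blob_kernel e (pos v i - pos v j))
            \<le> K * norm ((pos u i - pos u j) - (pos v i - pos v j))"
          unfolding K_def by (rule blob_kernel_lipschitz) (use \<open>e > 0\<close> in auto)
        also have "(pos u i - pos u j) - (pos v i - pos v j) = (pos u i - pos v i) - (pos u j - pos v j)"
          by simp
        also have "norm \<dots> \<le> 2 * norm (u - v)"
          using norm_triangle_ineq4[of "pos u i - pos v i" "pos u j - pos v j"] uv[of i] uv[of j]
          by linarith
        finally have "norm (blob_kernel e (pos u i - pos u j) - blob_kernel e (pos v i - pos v j))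
            \<le> K * (2 * norm (u - v))"
          using \<open>K \<ge> 0\<close> by (simp add: mult_left_mono)
        then show "norm (m j *\<^sub>R (blob_kernel e (pos u i - pos u j) - blob_kernel e (pos v i - pos v j)))
            \<le> \<bar>m j\<bar> * (K * (2 * norm (u - v)))"
          by (simp add: mult_left_mono)
      qed
      also have "\<dots> = 2 * K * W * norm (u - v)"
        by (simp add: W_def sum_distrib_right sum_distrib_left mult_ac)
      finally show ?thesis .
    next
      case False
      then have "dist (F u k) (F v k) = 0" by (simp only: F_def emb) simp
      then show ?thesis using \<open>K \<ge> 0\<close> \<open>W \<ge> 0\<close> by simp
    qed
    then have "dist (F u) (F v) \<le> 2 * K * W * norm (u - v)" by (rule dist_bound)
    also have "\<dots> \<le> L * norm (u - v)" by (simp add: L_def mult_right_mono)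
    finally show ?thesis by (simp add: dist_norm)
  qed
  obtain u where u: "u 0 = emb x0" "\<And>t. t \<ge> 0 \<Longrightarrow> (u has_vector_derivative F (u t)) (at t within {0..})"
    using lipschitz_ode_global_solution[of L F "emb x0"] \<open>L > 0\<close> lip by blast
  have "blob_solution n m e {0..} (\<lambda>t. pos (u t))"
    unfolding blob_solution_def
  proof (intro ballI)
    fix t :: real and i assume "t \<in> {0..}" "i \<in> {1..n}"
    then show "((\<lambda>s. pos (u s) i) has_vector_derivative blob_velocity n m e (pos (u t)) i) (at t within {0..})"
      using bounded_linear.has_vector_derivative[OF bounded_linear_apply_bcontfun u(2), of t "discrete i"]
      by (simp add: F_def emb pos_def discrete_inverse)
  qed
  moreover have "\<forall>i\<in>{1..n}. pos (u 0) i = x0 i"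
    by (simp add: pos_def u(1) emb discrete_inverse)
  ultimately show ?thesis by blast
qed

section \<open>The weighted sum of squared distances in a cluster\<close>

definition pair_form :: "(nat \<Rightarrow> real) \<Rightarrow> nat set \<Rightarrow> (nat \<Rightarrow> 'a::real_inner) \<Rightarrow> real" where
  "pair_form m P X = (\<Sum>i\<in>P. \<Sum>j\<in>P. m i * m j * (norm (X i - X j))\<^sup>2)"

text \<open>
  Lagrange's identity with weights. With \<open>b\<close> the velocity it expresses the rate of change of
  the weighted sum of squared distances by momentum and virial; with \<open>a = b\<close> it compares that
  sum with a moment of inertia.
\<close>

lemma weighted_pair_sum:
  fixes a b :: "'i \<Rightarrow> 'a::real_inner"
  shows "(\<Sum>i\<in>P. \<Sum>j\<in>P. m i * m j * ((a i - a j) \<bullet> (b i - b j)))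
    = 2 * (sum m P * (\<Sum>i\<in>P. m i * (a i \<bullet> b i)) - (\<Sum>i\<in>P. m i *\<^sub>R a i) \<bullet> (\<Sum>i\<in>P. m i *\<^sub>R b i))"
proof -
  have 1: "(\<Sum>i\<in>P. \<Sum>j\<in>P. m i * m j * (a i \<bullet> b i)) = sum m P * (\<Sum>i\<in>P. m i * (a i \<bullet> b i))"
    by (subst sum_product, subst sum.swap) (simp add: mult_ac)
  have 2: "(\<Sum>i\<in>P. \<Sum>j\<in>P. m i * m j * (a j \<bullet> b j)) = sum m P * (\<Sum>i\<in>P. m i * (a i \<bullet> b i))"
    by (subst sum_product) (simp add: mult_ac)
  have 4: "(\<Sum>i\<in>P. \<Sum>j\<in>P. m i * m j * (a j \<bullet> b i)) = (\<Sum>i\<in>P. m i *\<^sub>R a i) \<bullet> (\<Sum>i\<in>P. m i *\<^sub>R b i)"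
    by (simp add: inner_sum_left inner_sum_right sum_distrib_left mult_ac)
  have 3: "(\<Sum>i\<in>P. \<Sum>j\<in>P. m i * m j * (a i \<bullet> b j)) = (\<Sum>i\<in>P. m i *\<^sub>R a i) \<bullet> (\<Sum>i\<in>P. m i *\<^sub>R b i)"
    unfolding 4[symmetric] by (subst sum.swap) (simp add: mult_ac)
  have "(\<Sum>i\<in>P. \<Sum>j\<in>P. m i * m j * ((a i - a j) \<bullet> (b i - b j)))
      = (\<Sum>i\<in>P. \<Sum>j\<in>P. m i * m j * (a i \<bullet> b i)) + (\<Sum>i\<in>P. \<Sum>j\<in>P. m i * m j * (a j \<bullet> b j))
       - (\<Sum>i\<in>P. \<Sum>j\<in>P. m i * m j * (a i \<bullet> b j)) - (\<Sum>i\<in>P. \<Sum>j\<in>P. m i * m j * (a j \<bullet> b i))"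
    by (simp add: inner_diff_left inner_diff_right algebra_simps sum.distrib sum_subtractf)
  then show ?thesis unfolding 1 2 3 4 by simp
qed

definition self_velocity ::
  "(nat \<Rightarrow> real) \<Rightarrow> real \<Rightarrow> nat set \<Rightarrow> (nat \<Rightarrow> real^2) \<Rightarrow> nat \<Rightarrow> real^2" where
  "self_velocity m e P X i = (\<Sum>k\<in>P. m k *\<^sub>R blob_kernel e (X i - X k))"

text \<open>
  Action equals reaction, as the kernel is odd.
\<close>

lemma self_momentum_zero: "(\<Sum>i\<in>P. m i *\<^sub>R self_velocity m e P X i) = 0"
proof -
  let ?S = "\<Sum>i\<in>P. \<Sum>k\<in>P. (m i * m k) *\<^sub>R blob_kernel e (X i - X k)"
  have "?S = (\<Sum>i\<in>P. \<Sum>k\<in>P. (m i * m k) *\<^sub>R blob_kernel e (X k - X i))"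
    by (subst sum.swap) (simp add: mult.commute)
  also have "\<dots> = - ?S"
    by (subst blob_kernel_diff_swap) (simp add: sum_negf)
  finally have "?S = - ?S" .
  then have "?S + ?S = 0" by (simp only: eq_neg_iff_add_eq_0[symmetric])
  then have "2 *\<^sub>R ?S = 0" by (simp only: scaleR_2)
  then have "?S = 0" by (simp only: scaleR_eq_0_iff) simp
  then show ?thesis by (simp add: self_velocity_def scaleR_sum_right)
qed

text \<open>
  Exchanging the two indices and averaging leaves the products of \<open>x\<^sub>i - x\<^sub>k\<close> with the kernel at
  \<open>x\<^sub>i - x\<^sub>k\<close>, which are orthogonal.
\<close>

lemma self_virial_zero: "(\<Sum>i\<in>P. m i * (X i \<bullet> self_velocity m e P X i)) = 0"
proof -
  let ?V = "\<Sum>i\<in>P. \<Sum>k\<in>P. m i * m k * (X i \<bullet> blob_kernel e (X i - X k))"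
  have "?V = (\<Sum>i\<in>P. \<Sum>k\<in>P. m i * m k * (X k \<bullet> blob_kernel e (X k - X i)))"
    by (subst sum.swap) (simp add: mult.commute)
  also have "\<dots> = (\<Sum>i\<in>P. \<Sum>k\<in>P. - (m i * m k * (X k \<bullet> blob_kernel e (X i - X k))))"
    by (subst blob_kernel_diff_swap) simp
  finally have "?V + ?V = (\<Sum>i\<in>P. \<Sum>k\<in>P. m i * m k * ((X i - X k) \<bullet> blob_kernel e (X i - X k)))"
    by (simp add: sum.distrib sum_subtractf sum_negf inner_diff_left algebra_simps)
  then have "?V = 0" by (simp add: inner_blob_kernel_self)
  then show ?thesis by (simp add: self_velocity_def inner_sum_right sum_distrib_left mult_ac)
qed

lemma pair_form_self_rate_zero:
  "(\<Sum>i\<in>P. \<Sum>j\<in>P. m i * m j * ((X i - X j) \<bullet> (self_velocity m e P X i - self_velocity m e P X j))) = 0"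
  by (simp add: weighted_pair_sum self_momentum_zero self_virial_zero)

definition pair_form_rate where
  "pair_form_rate n m e P X = (\<Sum>i\<in>P. \<Sum>j\<in>P. m i * m j *
     (2 * ((X i - X j) \<bullet> (blob_velocity n m e X i - blob_velocity n m e X j))))"

lemma pair_form_has_derivative:
  assumes sol: "blob_solution n m e J x" and "t \<in> J" "P \<subseteq> {1..n}"
  shows "((\<lambda>s. pair_form m P (x s)) has_real_derivative pair_form_rate n m e P (x t)) (at t within J)"
proof -
  have sq: "((\<lambda>s. (norm (x s i - x s j))\<^sup>2) has_real_derivative
      2 * ((x t i - x t j) \<bullet> (blob_velocity n m e (x t) i - blob_velocity n m e (x t) j))) (at t within J)"
    if "i \<in> P" "j \<in> P" for i j
  proof -
    have "((\<lambda>s. x s i - x s j) has_vector_derivative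
      (blob_velocity n m e (x t) i - blob_velocity n m e (x t) j)) (at t within J)"
      using assms that by (intro has_vector_derivative_diff) (auto simp: blob_solution_def)
    then show ?thesis
      by (rule has_real_derivative_norm_square)
  qed
  show ?thesis unfolding pair_form_def pair_form_rate_def
    by (intro DERIV_sum DERIV_cmult sq)
qed

text \<open>
  Only the velocity induced from outside \<open>P\<close> contributes, and its differences inside \<open>P\<close> are
  controlled by the Lipschitz bound of the kernel at distance \<open>r\<close>. For \<open>P = {1..n}\<close> the bound is zero:
  the form of the whole system is conserved.
\<close>

lemma abs_pair_form_rate_le:
  assumes "P \<subseteq> {1..n}" "r > 0"
    and far: "\<And>i k. \<lbrakk>i \<in> P; k \<in> {1..n} - P\<rbrakk> \<Longrightarrow> r \<le> norm (X i - X k)"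
  shows "\<bar>pair_form_rate n m e P X\<bar>
    \<le> 6 / r\<^sup>2 * (\<Sum>k\<in>{1..n} - P. \<bar>m k\<bar>) * pair_form (\<lambda>i. \<bar>m i\<bar>) P X"
proof -
  define w where "w = (\<lambda>i. \<Sum>k\<in>{1..n} - P. m k *\<^sub>R blob_kernel e (X i - X k))"
  define W where "W = (\<Sum>k\<in>{1..n} - P. \<bar>m k\<bar>)"
  have split: "blob_velocity n m e X i = self_velocity m e P X i + w i" for i
    unfolding blob_velocity_def self_velocity_def w_def
    by (subst sum.subset_diff[OF assms(1)]) (simp_all add: add.commute)
  have "pair_form_rate n m e P X = 
     2 * (\<Sum>i\<in>P. \<Sum>j\<in>P. m i * m j * ((X i - X j) \<bullet> (self_velocity m e P X i - self_velocity m e P X j)))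
     + (\<Sum>i\<in>P. \<Sum>j\<in>P. 2 * (m i * m j * ((X i - X j) \<bullet> (w i - w j))))"
    unfolding pair_form_rate_def split sum_distrib_left sum.distrib[symmetric]
    by (intro sum.cong refl) (simp add: inner_diff_right inner_add_right algebra_simps)
  then have eq: "pair_form_rate n m e P X = (\<Sum>i\<in>P. \<Sum>j\<in>P. 2 * (m i * m j * ((X i - X j) \<bullet> (w i - w j))))"
    by (simp add: pair_form_self_rate_zero)
  have wd: "norm (w i - w j) \<le> 3 / r\<^sup>2 * W * norm (X i - X j)" if "i \<in> P" "j \<in> P" for i j
  proof -
    have "w i - w j = (\<Sum>k\<in>{1..n} - P. m k *\<^sub>R (blob_kernel e (X i - X k) - blob_kernel e (X j - X k)))"
      by (simp add: w_def sum_subtractf scaleR_diff_right)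
    then have "norm (w i - w j) \<le> (\<Sum>k\<in>{1..n} - P. \<bar>m k\<bar> * norm (blob_kernel e (X i - X k) - blob_kernel e (X j - X k)))"
      by (simp add: sum_norm_le)
    also have "\<dots> \<le> (\<Sum>k\<in>{1..n} - P. \<bar>m k\<bar> * (3 / r\<^sup>2 * norm ((X i - X k) - (X j - X k))))"
      by (intro sum_mono mult_left_mono blob_kernel_lipschitz)
        (use far that \<open>r > 0\<close> in \<open>auto simp: le_max_iff_disj\<close>)
    finally show ?thesis by (simp add: W_def sum_distrib_left sum_distrib_right mult_ac)
  qed
  have "\<bar>pair_form_rate n m e P X\<bar> \<le> (\<Sum>i\<in>P. \<Sum>j\<in>P. \<bar>2 * (m i * m j * ((X i - X j) \<bullet> (w i - w j)))\<bar>)"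
    unfolding eq by (intro order_trans[OF sum_abs] sum_mono sum_abs)
  also have "\<dots> \<le> (\<Sum>i\<in>P. \<Sum>j\<in>P. 6 / r\<^sup>2 * W * (\<bar>m i\<bar> * \<bar>m j\<bar> * (norm (X i - X j))\<^sup>2))"
  proof (intro sum_mono)
    fix i j assume "i \<in> P" "j \<in> P"
    have "\<bar>(X i - X j) \<bullet> (w i - w j)\<bar> \<le> norm (X i - X j) * (3 / r\<^sup>2 * W * norm (X i - X j))"
      by (rule order_trans[OF Cauchy_Schwarz_ineq2 mult_left_mono]) (use wd \<open>i \<in> P\<close> \<open>j \<in> P\<close> in auto)
    then have "2 * (\<bar>m i\<bar> * \<bar>m j\<bar>) * \<bar>(X i - X j) \<bullet> (w i - w j)\<bar>
        \<le> 2 * (\<bar>m i\<bar> * \<bar>m j\<bar>) * (norm (X i - X j) * (3 / r\<^sup>2 * W * norm (X i - X j)))"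
      by (rule mult_left_mono) simp
    then show "\<bar>2 * (m i * m j * ((X i - X j) \<bullet> (w i - w j)))\<bar>
        \<le> 6 / r\<^sup>2 * W * (\<bar>m i\<bar> * \<bar>m j\<bar> * (norm (X i - X j))\<^sup>2)"
      by (simp add: abs_mult power2_eq_square mult_ac)
  qed
  also have "\<dots> = 6 / r\<^sup>2 * W * pair_form (\<lambda>i. \<bar>m i\<bar>) P X"
    by (simp add: pair_form_def sum_distrib_left)
  finally show ?thesis by (simp add: W_def)
qed

lemma blob_center_has_derivative_zero:
  assumes sol: "blob_solution n m e J x" and "t \<in> J"
  shows "((\<lambda>s. \<Sum>i\<in>{1..n}. m i *\<^sub>R x s i) has_vector_derivative 0) (at t within J)"
proof -
  have "((\<lambda>s. \<Sum>i\<in>{1..n}. m i *\<^sub>R x s i) has_vector_derivative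
      (\<Sum>i\<in>{1..n}. m i *\<^sub>R blob_velocity n m e (x t) i)) (at t within J)"
    by (intro has_vector_derivative_sum bounded_linear.has_vector_derivative[OF bounded_linear_scaleR_right])
       (use assms in \<open>auto simp: blob_solution_def\<close>)
  moreover have "(\<Sum>i\<in>{1..n}. m i *\<^sub>R blob_velocity n m e (x t) i) = 0"
    using self_momentum_zero[of m e "{1..n}" "x t"] by (simp add: blob_velocity_def self_velocity_def)
  ultimately show ?thesis by simp
qed

lemma pair_form_insert:
  assumes "finite P" "a \<notin> P"
  shows "pair_form m (insert a P) X = pair_form m P X + 2 * m a * (\<Sum>j\<in>P. m j * (norm (X a - X j))\<^sup>2)"
  using assms unfolding pair_form_def
  by (simp add: sum.distrib sum_distrib_left norm_minus_commute mult_ac)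

text \<open>
  The two sides differ by twice the square of the first moment about \<open>c\<close>.
\<close>

lemma pair_form_le_moment:
  "pair_form m P X \<le> 2 * sum m P * (\<Sum>j\<in>P. m j * (norm (c - X j))\<^sup>2)"
proof -
  have "pair_form m P X = (\<Sum>i\<in>P. \<Sum>j\<in>P. m i * m j * (((c - X i) - (c - X j)) \<bullet> ((c - X i) - (c - X j))))"
    by (simp add: pair_form_def power2_norm_eq_inner[symmetric] norm_minus_commute)
  also have "\<dots> \<le> 2 * (sum m P * (\<Sum>j\<in>P. m j * ((c - X j) \<bullet> (c - X j))))"
    unfolding weighted_pair_sum by simp
  finally show ?thesis by (simp add: power2_norm_eq_inner mult_ac)
qed

lemma abs_pair_form_le: "\<bar>pair_form m P X\<bar> \<le> pair_form (\<lambda>i. \<bar>m i\<bar>) P X"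
  unfolding pair_form_def
  by (intro order_trans[OF sum_abs] sum_mono) (simp add: abs_mult)

lemma pair_form_abs_nonneg: "0 \<le> pair_form (\<lambda>i. \<bar>m i\<bar>) P X"
  unfolding pair_form_def by (intro sum_nonneg) simp

lemma pair_le_pair_form_abs:
  assumes "finite P" "i \<in> P" "j \<in> P"
  shows "\<bar>m i\<bar> * \<bar>m j\<bar> * (norm (X i - X j))\<^sup>2 \<le> pair_form (\<lambda>i. \<bar>m i\<bar>) P X"
proof -
  have "\<bar>m i\<bar> * \<bar>m j\<bar> * (norm (X i - X j))\<^sup>2 \<le> (\<Sum>j\<in>P. \<bar>m i\<bar> * \<bar>m j\<bar> * (norm (X i - X j))\<^sup>2)"
    using assms by (intro member_le_sum[of j]) auto
  also have "\<dots> \<le> pair_form (\<lambda>i. \<bar>m i\<bar>) P X"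
    unfolding pair_form_def using assms
    by (intro member_le_sum[of i _ "\<lambda>i. \<Sum>j\<in>P. \<bar>m i\<bar> * \<bar>m j\<bar> * (norm (X i - X j))\<^sup>2"] sum_nonneg) auto
  finally show ?thesis .
qed

lemma pair_form_abs_ge:
  assumes "finite P" "i \<in> P" "j \<in> P" and "\<mu> \<ge> 0" "\<And>i. i \<in> P \<Longrightarrow> \<mu> \<le> \<bar>m i\<bar>"
  shows "(\<mu> * norm (X i - X j))\<^sup>2 \<le> pair_form (\<lambda>i. \<bar>m i\<bar>) P X"
proof -
  have "(\<mu> * norm (X i - X j))\<^sup>2 = \<mu> * \<mu> * (norm (X i - X j))\<^sup>2"
    by (simp add: power2_eq_square)
  also have "\<dots> \<le> \<bar>m i\<bar> * \<bar>m j\<bar> * (norm (X i - X j))\<^sup>2"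
    using assms by (intro mult_right_mono mult_mono) auto
  also have "\<dots> \<le> pair_form (\<lambda>i. \<bar>m i\<bar>) P X"
    using assms by (intro pair_le_pair_form_abs)
  finally show ?thesis .
qed

lemma pair_form_abs_le:
  assumes "\<And>i j. i \<in> P \<Longrightarrow> j \<in> P \<Longrightarrow> norm (X i - X j) \<le> d"
  shows "pair_form (\<lambda>i. \<bar>m i\<bar>) P X \<le> ((\<Sum>i\<in>P. \<bar>m i\<bar>) * d)\<^sup>2"
proof -
  have "pair_form (\<lambda>i. \<bar>m i\<bar>) P X \<le> (\<Sum>i\<in>P. \<Sum>j\<in>P. \<bar>m i\<bar> * \<bar>m j\<bar> * d\<^sup>2)"
    unfolding pair_form_def using assms by (intro sum_mono mult_left_mono power_mono) auto
  also have "\<dots> = ((\<Sum>i\<in>P. \<bar>m i\<bar>) * d)\<^sup>2"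
    by (simp add: power2_eq_square sum_product sum_distrib_left sum_distrib_right mult_ac)
  finally show ?thesis .
qed

section \<open>Coercivity for a dominant negative mass\<close>

locale dominant_negative_vortex =
  fixes n :: nat and m :: "nat \<Rightarrow> real"
  assumes n_pos: "n \<ge> 1"
    and mass_pos: "\<And>i. i \<in> {2..n} \<Longrightarrow> m i > 0"
    and mass_neg: "m 1 < 0"
    and dominant: "- m 1 > (\<Sum>i = 2..n. m i)"
begin

text \<open>
  The comparison constant between the form with signed masses and the form with their absolute
  values. The denominator is positive because the negative mass dominates strictly.
\<close>

definition coercivity :: real where
  "coercivity = 2 * (- m 1) / (- m 1 - (\<Sum>i = 2..n. m i))"

definition cluster_sign :: "nat set \<Rightarrow> real" where
  "cluster_sign P = (if 1 \<in> P then - 1 else 1)"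

lemma coercivity_ge_1: "coercivity \<ge> 1"
proof -
  have "(\<Sum>i = 2..n. m i) \<ge> 0" using mass_pos by (intro sum_nonneg) (auto intro: less_imp_le)
  then show ?thesis using dominant mass_neg by (simp add: coercivity_def field_simps)
qed

text \<open>
  A cluster of positive masses gives equality of the two forms. If \<open>1 \<in> P\<close>, let \<open>I\<close> be the moment of
  inertia of the positive vortices about vortex \<open>1\<close>. Their mutual terms sum to at most \<open>2 S I\<close>,
  where \<open>S\<close> is the sum of the positive masses, and the terms with vortex \<open>1\<close> sum to \<open>2 m\<^sub>1 I\<close>; the latter win.
\<close>

lemma pair_form_coercive:
  assumes "P \<subseteq> {1..n}"
  shows "pair_form (\<lambda>i. \<bar>m i\<bar>) P X \<le> coercivity * (cluster_sign P * pair_form m P X)"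
proof -
  define P' where "P' = P - {1}"
  have P': "finite P'" "1 \<notin> P'" "P' \<subseteq> {2..n}"
    using assms by (auto simp: P'_def finite_subset)
  have m_pos: "m i > 0" if "i \<in> P'" for i using that P'(3) mass_pos by auto
  have abs_eq: "pair_form (\<lambda>i. \<bar>m i\<bar>) P' X = pair_form m P' X"
    unfolding pair_form_def by (intro sum.cong) (auto dest!: m_pos)
  show ?thesis
  proof (cases "1 \<in> P")
    case False
    then have "P = P'" by (simp add: P'_def)
    moreover have "1 * pair_form m P' X \<le> coercivity * pair_form m P' X"
      using coercivity_ge_1 pair_form_abs_nonneg[of m P' X] by (intro mult_right_mono) (simp_all add: abs_eq)
    ultimately show ?thesis using False by (simp add: cluster_sign_def abs_eq)
  next
    case True
    then have P: "P = insert 1 P'" by (auto simp: P'_def)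
    define I where "I = (\<Sum>j\<in>P'. m j * (norm (X 1 - X j))\<^sup>2)"
    define S where "S = (\<Sum>i = 2..n. m i)"
    have I: "I \<ge> 0" unfolding I_def
      by (intro sum_nonneg mult_nonneg_nonneg) (auto dest!: m_pos)
    have "sum m P' \<le> S" unfolding S_def using P' mass_pos
      by (intro sum_mono2) (auto intro: less_imp_le)
    then have "2 * sum m P' * I \<le> 2 * S * I" using I by (simp add: mult_right_mono)
    then have form: "pair_form m P' X \<le> 2 * S * I"
      using pair_form_le_moment[of m P' X "X 1"] by (simp add: I_def)
    have abs_form: "pair_form (\<lambda>i. \<bar>m i\<bar>) P X = pair_form m P' X - 2 * m 1 * I"
    proof -
      have "(\<Sum>j\<in>P'. \<bar>m j\<bar> * (norm (X 1 - X j))\<^sup>2) = I"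
        unfolding I_def by (intro sum.cong) (auto dest!: m_pos)
      then show ?thesis
        unfolding P using pair_form_insert[OF P'(1,2), of "\<lambda>i. \<bar>m i\<bar>" X] mass_neg by (simp add: abs_eq)
    qed
    have L: "pair_form m P X = pair_form m P' X + 2 * m 1 * I"
      unfolding P I_def by (rule pair_form_insert[OF P'(1,2)])
    have \<kappa>: "- m 1 - S > 0" using dominant by (simp add: S_def)
    have low: "2 * (- m 1 - S) * I \<le> - pair_form m P X"
      unfolding L using form by (simp add: algebra_simps)
    have "pair_form (\<lambda>i. \<bar>m i\<bar>) P X \<le> 4 * (- m 1) * I"
      unfolding abs_form using form mult_right_mono[OF less_imp_le[OF \<kappa>] I] by (simp add: algebra_simps)
    also have "\<dots> = coercivity * (2 * (- m 1 - S) * I)"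
      using \<kappa> by (simp add: coercivity_def S_def[symmetric] field_simps)
    also have "\<dots> \<le> coercivity * (- pair_form m P X)"
      using low coercivity_ge_1 by (intro mult_left_mono) auto
    finally show ?thesis using True by (simp add: cluster_sign_def)
  qed
qed

lemma cluster_sign_pair_form_le: "cluster_sign P * pair_form m P X \<le> pair_form (\<lambda>i. \<bar>m i\<bar>) P X"
  using abs_pair_form_le[of m P X] by (auto simp: cluster_sign_def)

lemma masses_bounded_below: "\<exists>\<mu>>0. \<forall>i\<in>{1..n}. \<mu> \<le> \<bar>m i\<bar>"
proof (intro exI conjI ballI)
  let ?\<mu> = "MIN i\<in>{1..n}. \<bar>m i\<bar>"
  have "m i \<noteq> 0" if "i \<in> {1..n}" for i
    using that mass_pos[of i] mass_neg by (cases "i = 1") auto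
  then show "?\<mu> > 0" using n_pos by simp
  show "?\<mu> \<le> \<bar>m i\<bar>" if "i \<in> {1..n}" for i using that by simp
qed

section \<open>Clusters do not collapse\<close>

text \<open>
  The constant \<open>d\<close> is quantified outside the regularisation parameter \<open>e\<close> and the solution. This is
  what later permits to choose \<open>e\<close> as small as the distances that the solution will have.
\<close>

definition clusters_spread :: "(nat \<Rightarrow> real^2) \<Rightarrow> real \<Rightarrow> nat \<Rightarrow> real \<Rightarrow> bool" where
  "clusters_spread x0 T k d \<longleftrightarrow>
     (\<forall>e x. blob_solution n m e {0..T} x \<and> (\<forall>i\<in>{1..n}. x 0 i = x0 i) \<longrightarrow>
       (\<forall>P\<subseteq>{1..n}. card P = k \<longrightarrow> (\<forall>t\<in>{0..T}. \<exists>i\<in>P. \<exists>j\<in>P. d \<le> norm (x t i - x t j))))"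

text \<open>
  The form of a small cluster \<open>P\<close> of size \<open>k\<close> decays at most exponentially as long as it is small,
  because then all other vortices are at distance at least \<open>r = d' / 2\<close>: otherwise \<open>P\<close> with one of
  them would be a cluster of size \<open>k + 1\<close> and diameter below \<open>d'\<close>.
\<close>

lemma clusters_spread_step:
  assumes IH: "clusters_spread x0 T (Suc k) d'" and "d' > 0" "k \<ge> 2" "T \<ge> 0"
    and "d0 > 0"
    and init: "\<And>i j. \<lbrakk>i \<in> {1..n}; j \<in> {1..n}; i \<noteq> j\<rbrakk> \<Longrightarrow> d0 \<le> norm (x0 i - x0 j)"
  shows "\<exists>d>0. clusters_spread x0 T k d"
proof -
  obtain \<mu> where \<mu>: "\<mu> > 0" "\<And>i. i \<in> {1..n} \<Longrightarrow> \<mu> \<le> \<bar>m i\<bar>" using masses_bounded_below by blast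
  define A where "A = coercivity"
  have A: "A \<ge> 1" using coercivity_ge_1 by (simp add: A_def)
  define r where "r = d' / 2"
  have r: "r > 0" using \<open>d' > 0\<close> by (simp add: r_def)
  define W where "W = (\<Sum>i\<in>{1..n}. \<bar>m i\<bar>)"
  have W: "W > 0" unfolding W_def using n_pos
    by (intro sum_pos less_le_trans[OF \<mu>(1) \<mu>(2)]) auto
  define \<rho> where "\<rho> = min r d0"
  have \<rho>: "\<rho> > 0" "\<rho> \<le> r" "\<rho> \<le> d0" using r \<open>d0 > 0\<close> by (auto simp: \<rho>_def)
  \<comment> \<open>Below the level \<open>\<delta>\<close> the form forces all distances in the cluster below \<open>r\<close>; the initial
    configuration lies above it because \<open>\<rho> \<le> d0\<close>.\<close>
  define \<delta> where "\<delta> = (\<mu> * \<rho>)\<^sup>2 / A"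
  have \<delta>: "\<delta> > 0" using A \<mu> \<rho> by (simp add: \<delta>_def)
  define C where "C = 6 / r\<^sup>2 * W * A"
  have C: "C \<ge> 0" using W A by (simp add: C_def)
  define c where "c = \<delta> * exp (- C * T)"
  have c: "c > 0" using \<delta> by (simp add: c_def)
  \<comment> \<open>A cluster of diameter at most \<open>d\<close> has form at most \<open>c / 2\<close>.\<close>
  define d where "d = sqrt (c / 2) / W"
  have d: "d > 0" "(W * d)\<^sup>2 = c / 2" using c W by (simp_all add: d_def)
  have pair_lower: "(\<mu> * norm (X i - X j))\<^sup>2 \<le> pair_form (\<lambda>i. \<bar>m i\<bar>) P X"
    if "P \<subseteq> {1..n}" "i \<in> P" "j \<in> P" for P i j and X :: "nat \<Rightarrow> real^2"
    using \<mu> that by (intro pair_form_abs_ge) (auto intro: finite_subset)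
  have "clusters_spread x0 T k d"
    unfolding clusters_spread_def
  proof (intro allI impI ballI; elim conjE)
    fix e x P t
    assume sol: "blob_solution n m e {0..T} x" and x0: "\<forall>i\<in>{1..n}. x 0 i = x0 i"
      and P: "P \<subseteq> {1..n}" "card P = k" and t: "t \<in> {0..T}"
    have finP: "finite P" using P(1) finite_subset by blast
    define f where "f = (\<lambda>s. cluster_sign P * pair_form m P (x s))"
    define f' where "f' = (\<lambda>s. cluster_sign P * pair_form_rate n m e P (x s))"
    define Q where "Q = (\<lambda>s. pair_form (\<lambda>i. \<bar>m i\<bar>) P (x s))"
    have fQ: "f s \<le> Q s" "Q s \<le> A * f s" for s
      unfolding f_def Q_def A_def
      by (rule cluster_sign_pair_form_le, rule pair_form_coercive[OF P(1)])
    have f0: "\<delta> \<le> f 0"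
    proof -
      have "\<not> is_singleton P" "P \<noteq> {}" using P(2) \<open>k \<ge> 2\<close> by (auto simp: is_singleton_altdef)
      then obtain i j where ij: "i \<in> P" "j \<in> P" "i \<noteq> j" by (metis is_singletonI' )
      have "(\<mu> * \<rho>)\<^sup>2 \<le> (\<mu> * norm (x 0 i - x 0 j))\<^sup>2"
        using init[of i j] ij P(1) x0 \<rho> \<mu> by (intro power_mono mult_left_mono) (auto simp: subset_iff)
      also have "\<dots> \<le> A * f 0" using pair_lower[OF P(1) ij(1,2), of "x 0"] fQ(2)[of 0] by (simp add: Q_def)
      finally show ?thesis using A by (simp add: \<delta>_def field_simps)
    qed
    have "\<delta> * exp (- C * t) \<le> f t"
    proof (rule barrier_lower_bound[where f = f and t = t and T = T and f' = f'])
      fix s assume s: "s \<in> {0..T}"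
      show "(f has_real_derivative f' s) (at s within {0..T})"
        unfolding f_def f'_def by (intro DERIV_cmult pair_form_has_derivative[OF sol s P(1)])
      assume "f s < \<delta>"
      then have "A * f s < (\<mu> * \<rho>)\<^sup>2" using A by (simp add: \<delta>_def field_simps)
      then have small: "norm (x s i - x s j) < r" if "i \<in> P" "j \<in> P" for i j
      proof -
        have "(\<mu> * norm (x s i - x s j))\<^sup>2 < (\<mu> * \<rho>)\<^sup>2"
          using pair_lower[OF P(1) that, of "x s"] fQ(2)[of s] \<open>A * f s < _\<close> by (simp add: Q_def)
        then have "\<mu> * norm (x s i - x s j) < \<mu> * \<rho>" by (rule power2_less_imp_less) (use \<mu> \<rho> in simp)
        then show ?thesis using \<mu> \<rho> by simp
      qed
      have far: "r \<le> norm (x s i - x s l)" if "i \<in> P" "l \<in> {1..n} - P" for i l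
      proof (rule ccontr)
        assume near: "\<not> ?thesis"
        have nl: "norm (x s j - x s l) < d'" if "j \<in> P" for j
        proof -
          have "norm (x s j - x s l) \<le> norm (x s j - x s i) + norm (x s i - x s l)" by norm
          then show ?thesis using small[OF that \<open>i \<in> P\<close>] near by (simp add: r_def)
        qed
        have "card (insert l P) = Suc k" "insert l P \<subseteq> {1..n}" using that P finP by auto
        then obtain a b where ab: "a \<in> insert l P" "b \<in> insert l P" "d' \<le> norm (x s a - x s b)"
          using IH sol x0 s unfolding clusters_spread_def by meson
        then show False
          using nl[of a] nl[of b] small[of a b] \<open>d' > 0\<close> by (auto simp: norm_minus_commute r_def)
      qed
      have "\<bar>pair_form_rate n m e P (x s)\<bar> \<le> 6 / r\<^sup>2 * (\<Sum>k\<in>{1..n} - P. \<bar>m k\<bar>) * Q s"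
        unfolding Q_def by (rule abs_pair_form_rate_le[OF P(1) r far])
      also have "\<dots> \<le> 6 / r\<^sup>2 * W * (A * f s)"
        unfolding W_def
        by (intro mult_mono fQ sum_mono2 mult_left_mono) (auto simp: Q_def pair_form_abs_nonneg intro: sum_nonneg)
      finally have "\<bar>pair_form_rate n m e P (x s)\<bar> \<le> C * f s" by (simp add: C_def mult_ac)
      then show "- C * f s \<le> f' s" by (auto simp: f'_def cluster_sign_def)
    qed (use C \<delta> f0 t in auto)
    moreover have "c \<le> \<delta> * exp (- C * t)"
      using t C \<delta> by (simp add: c_def mult_left_mono)
    ultimately have "c \<le> Q t" using fQ(1)[of t] by linarith
    show "\<exists>i\<in>P. \<exists>j\<in>P. d \<le> norm (x t i - x t j)"
    proof (rule ccontr)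
      assume "\<not> ?thesis"
      then have "Q t \<le> ((\<Sum>i\<in>P. \<bar>m i\<bar>) * d)\<^sup>2"
        unfolding Q_def by (intro pair_form_abs_le) (force simp: not_le)
      also have "\<dots> \<le> (W * d)\<^sup>2"
        unfolding W_def using P(1) d
        by (intro power_mono mult_right_mono sum_mono2 mult_nonneg_nonneg sum_nonneg) auto
      finally show False using d c \<open>c \<le> Q t\<close> by simp
    qed
  qed
  then show ?thesis using d by blast
qed

text \<open>
  Induction from clusters of size \<open>n + 1\<close>, of which there are none, down to pairs.
\<close>

lemma uniform_separation:
  assumes "T \<ge> 0" and inj: "\<And>i j. \<lbrakk>i \<in> {1..n}; j \<in> {1..n}; i \<noteq> j\<rbrakk> \<Longrightarrow> x0 i \<noteq> x0 j"
  shows "\<exists>d>0. \<forall>e x. blob_solution n m e {0..T} x \<and> (\<forall>i\<in>{1..n}. x 0 i = x0 i) \<longrightarrow>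
    (\<forall>t\<in>{0..T}. \<forall>i\<in>{1..n}. \<forall>j\<in>{1..n}. i \<noteq> j \<longrightarrow> d \<le> norm (x t i - x t j))"
proof -
  \<comment> \<open>The number \<open>1\<close> only keeps the set nonempty when \<open>n = 1\<close>.\<close>
  define D where "D = insert 1 ((\<lambda>(i, j). norm (x0 i - x0 j)) ` {(i, j). i \<in> {1..n} \<and> j \<in> {1..n} \<and> i \<noteq> j})"
  have "finite {(i, j). i \<in> {1..n} \<and> j \<in> {1..n} \<and> i \<noteq> j}"
    by (rule finite_subset[of _ "{1..n} \<times> {1..n}"]) auto
  then have "finite D" by (simp add: D_def)
  moreover have "\<forall>y\<in>D. y > 0" using inj by (auto simp: D_def)
  ultimately have d0: "Min D > 0" and d0_le: "\<And>y. y \<in> D \<Longrightarrow> Min D \<le> y" by (auto simp: D_def)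
  have "\<exists>d>0. clusters_spread x0 T k d" if "2 \<le> k" "k \<le> Suc n" for k
    using that(2,1)
  proof (induction k rule: inc_induct)
    case base
    have "clusters_spread x0 T (Suc n) 1"
      unfolding clusters_spread_def
      by (auto dest: card_mono[rotated])
    then show ?case by (intro exI[of _ 1]) simp
  next
    case (step k)
    then obtain d' where "clusters_spread x0 T (Suc k) d'" "d' > 0" by auto
    show ?case
    proof (rule clusters_spread_step)
      show "Min D \<le> norm (x0 i - x0 j)" if "i \<in> {1..n}" "j \<in> {1..n}" "i \<noteq> j" for i j
        using that by (intro d0_le) (auto simp: D_def)
    qed fact+
  qed
  from this[of 2] obtain d where d: "d > 0" "clusters_spread x0 T 2 d" using n_pos by auto
  have "d \<le> norm (x t i - x t j)"
    if sol: "blob_solution n m e {0..T} x" "\<forall>i\<in>{1..n}. x 0 i = x0 i"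
       "t \<in> {0..T}" "i \<in> {1..n}" "j \<in> {1..n}" and ij: "i \<noteq> j" for e x t i j
  proof -
    have "card {i, j} = 2" "{i, j} \<subseteq> {1..n}" using sol ij by auto
    then obtain a b where "a \<in> {i, j}" "b \<in> {i, j}" "d \<le> norm (x t a - x t b)"
      using d(2) sol unfolding clusters_spread_def by meson
    then show ?thesis using d(1) by (auto simp: norm_minus_commute)
  qed
  then show ?thesis using d(1) by blast
qed

section \<open>Boundedness\<close>

text \<open>
  The conserved form of the whole system bounds the mutual distances, and
  \<open>M x\<^sub>i = (\<Sum>j. m\<^sub>j (x\<^sub>i - x\<^sub>j)) + (\<Sum>j. m\<^sub>j x\<^sub>j)\<close> with \<open>M\<close> the total mass then bounds the positions.
\<close>

lemma uniform_bound:
  "\<exists>R. \<forall>e T x. blob_solution n m e {0..T} x \<and> (\<forall>i\<in>{1..n}. x 0 i = x0 i) \<longrightarrow>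
    (\<forall>t\<in>{0..T}. \<forall>i\<in>{1..n}. norm (x t i) \<le> R)"
proof -
  obtain \<mu> where \<mu>: "\<mu> > 0" "\<And>i. i \<in> {1..n} \<Longrightarrow> \<mu> \<le> \<bar>m i\<bar>" using masses_bounded_below by blast
  define B where "B = coercivity * (cluster_sign {1..n} * pair_form m {1..n} x0)"
  define D where "D = sqrt B / \<mu>"
  define W where "W = (\<Sum>i\<in>{1..n}. \<bar>m i\<bar>)"
  define M where "M = (\<Sum>i\<in>{1..n}. m i)"
  have "M = m 1 + (\<Sum>i=2..n. m i)"
    using n_pos by (simp add: M_def sum.atLeast_Suc_atMost numeral_2_eq_2)
  then have M: "M < 0" using dominant by simp
  have "norm (x t i) \<le> (W * D + norm (\<Sum>j\<in>{1..n}. m j *\<^sub>R x0 j)) / \<bar>M\<bar>"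
    if sol: "blob_solution n m e {0..T} x" and init: "\<forall>i\<in>{1..n}. x 0 i = x0 i"
      and t: "t \<in> {0..T}" and i: "i \<in> {1..n}" for e T x t i
  proof -
    have rate0: "pair_form_rate n m e {1..n} (x s) = 0" for s
      using abs_pair_form_rate_le[of "{1..n}" n 1 "x s" m e] by simp
    have "pair_form m {1..n} (x t) = pair_form m {1..n} (x 0)"
    proof (rule has_derivative_zero_unique[of "{0..T}" "\<lambda>s. pair_form m {1..n} (x s)"])
      fix s assume "s \<in> {0..T}"
      then show "((\<lambda>s. pair_form m {1..n} (x s)) has_derivative (\<lambda>h. 0)) (at s within {0..T})"
        using pair_form_has_derivative[OF sol, of s "{1..n}"] rate0
        by (simp add: has_field_derivative_def lambda_zero)
    qed (use t in auto)
    also have "\<dots> = pair_form m {1..n} x0"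
      unfolding pair_form_def by (intro sum.cong refl) (simp add: init)
    finally have QB: "pair_form (\<lambda>i. \<bar>m i\<bar>) {1..n} (x t) \<le> B"
      using pair_form_coercive[of "{1..n}" "x t"] by (simp add: B_def)
    have D: "norm (x t i - x t j) \<le> D" if "j \<in> {1..n}" for j
    proof -
      have "(\<mu> * norm (x t i - x t j))\<^sup>2 \<le> B"
        using pair_form_abs_ge[of "{1..n}" i j \<mu> m "x t"] \<mu> i that QB by auto
      then have "\<mu> * norm (x t i - x t j) \<le> sqrt B" by (rule real_le_rsqrt)
      then show ?thesis using \<mu>(1) by (simp add: D_def field_simps)
    qed
    have center: "(\<Sum>j\<in>{1..n}. m j *\<^sub>R x t j) = (\<Sum>j\<in>{1..n}. m j *\<^sub>R x0 j)"
    proof -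
      have "(\<Sum>j\<in>{1..n}. m j *\<^sub>R x t j) = (\<Sum>j\<in>{1..n}. m j *\<^sub>R x 0 j)"
      proof (rule has_derivative_zero_unique[of "{0..T}" "\<lambda>s. \<Sum>j\<in>{1..n}. m j *\<^sub>R x s j"])
        fix s assume "s \<in> {0..T}"
        then show "((\<lambda>s. \<Sum>j\<in>{1..n}. m j *\<^sub>R x s j) has_derivative (\<lambda>h. 0)) (at s within {0..T})"
          using blob_center_has_derivative_zero[OF sol, of s] by (simp add: has_vector_derivative_def)
      qed (use t in auto)
      then show ?thesis by (simp add: init)
    qed
    have split: "M *\<^sub>R x t i = (\<Sum>j\<in>{1..n}. m j *\<^sub>R (x t i - x t j)) + (\<Sum>j\<in>{1..n}. m j *\<^sub>R x t j)"
      by (simp add: M_def scaleR_sum_left scaleR_diff_right sum_subtractf)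
    have "\<bar>M\<bar> * norm (x t i) = norm (M *\<^sub>R x t i)" by simp
    also have "\<dots> \<le> norm (\<Sum>j\<in>{1..n}. m j *\<^sub>R (x t i - x t j))
        + norm (\<Sum>j\<in>{1..n}. m j *\<^sub>R x0 j)"
      unfolding split center by (rule norm_triangle_ineq)
    also have "norm (\<Sum>j\<in>{1..n}. m j *\<^sub>R (x t i - x t j)) \<le> (\<Sum>j\<in>{1..n}. \<bar>m j\<bar> * D)"
      by (intro sum_norm_le) (simp add: D mult_left_mono)
    also have "\<dots> = W * D" by (simp add: W_def sum_distrib_right)
    finally show ?thesis using M by (simp add: field_simps)
  qed
  then show ?thesis by blast
qed

section \<open>The point vortex flow\<close>

lemma point_vortex_solution_blob_0:
  "point_vortex_solution n m J x \<Longrightarrow> blob_solution n m 0 J x"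
  by (subst point_vortex_solution_iff_blob_solution[symmetric]) (auto simp: point_vortex_solution_def)

text \<open>
  Both solutions keep their mutual distances above a common \<open>d > 0\<close>, so both solve the system
  regularised at \<open>d\<close>, which has unique solutions.
\<close>

lemma point_vortex_solution_unique:
  assumes sol: "point_vortex_solution n m {0..T} x" "point_vortex_solution n m {0..T} y"
    and init: "\<And>i. i \<in> {1..n} \<Longrightarrow> x 0 i = y 0 i"
    and t: "t \<in> {0..T}" and i: "i \<in> {1..n}"
  shows "x t i = y t i"
proof -
  have "T \<ge> 0" using t by simp
  moreover have "y 0 i \<noteq> y 0 j" if "i \<in> {1..n}" "j \<in> {1..n}" "i \<noteq> j" for i j
    using sol(2) that \<open>T \<ge> 0\<close> by (auto simp: point_vortex_solution_def)
  ultimately obtain d where d: "d > 0"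
    "\<And>e x t i j. \<lbrakk>blob_solution n m e {0..T} x; \<forall>i\<in>{1..n}. x 0 i = y 0 i;
       t \<in> {0..T}; i \<in> {1..n}; j \<in> {1..n}; i \<noteq> j\<rbrakk> \<Longrightarrow> d \<le> norm (x t i - x t j)"
    using uniform_separation[of T "y 0"] by blast
  have "blob_solution n m d {0..T} z"
    if z: "point_vortex_solution n m {0..T} z" and z0: "\<forall>i\<in>{1..n}. z 0 i = y 0 i" for z
  proof -
    have "d \<le> norm (z t i - z t j)" if "t \<in> {0..T}" "i \<in> {1..n}" "j \<in> {1..n}" "i \<noteq> j" for t i j
      using d(2)[OF point_vortex_solution_blob_0[OF z] z0] that by blast
    then show ?thesis
      using z by (subst point_vortex_solution_iff_blob_solution[symmetric])
        (auto simp: point_vortex_solution_def)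
  qed
  then show ?thesis using blob_solution_unique[OF d(1)] sol init t i by blast
qed

text \<open>
  The regularisation length is taken equal to the separation \<open>d\<close> that is guaranteed on the interval for
  every regularisation length.
\<close>

lemma point_vortex_solution_on_interval:
  assumes inj: "\<And>i j. \<lbrakk>i \<in> {1..n}; j \<in> {1..n}; i \<noteq> j\<rbrakk> \<Longrightarrow> x0 i \<noteq> x0 j" and "T \<ge> 0"
  shows "\<exists>x. point_vortex_solution n m {0..T} x \<and> (\<forall>i\<in>{1..n}. x 0 i = x0 i)"
proof -
  obtain d where d: "d > 0"
    "\<And>e x t i j. \<lbrakk>blob_solution n m e {0..T} x; \<forall>i\<in>{1..n}. x 0 i = x0 i;
       t \<in> {0..T}; i \<in> {1..n}; j \<in> {1..n}; i \<noteq> j\<rbrakk> \<Longrightarrow> d \<le> norm (x t i - x t j)"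
    using uniform_separation[of T x0] \<open>T \<ge> 0\<close> inj by blast
  obtain x where x: "blob_solution n m d {0..} x" "\<forall>i\<in>{1..n}. x 0 i = x0 i"
    using blob_solution_exists[OF d(1)] by blast
  have sol: "blob_solution n m d {0..T} x" by (rule blob_solution_subset[OF x(1)]) auto
  have sep: "d \<le> norm (x t i - x t j)" if "t \<in> {0..T}" "i \<in> {1..n}" "j \<in> {1..n}" "i \<noteq> j" for t i j
    using d(2)[OF sol] x(2) that by blast
  then have "x t i \<noteq> x t j" if "t \<in> {0..T}" "i \<in> {1..n}" "j \<in> {1..n}" "i \<noteq> j" for t i j
    using that d(1) by fastforce
  then have "point_vortex_solution n m {0..T} x"
    using point_vortex_solution_iff_blob_solution[of "{0..T}" n d x m] sep sol by blast
  then show ?thesis using x(2) by blast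
qed

lemma point_vortex_solution_global:
  assumes inj: "\<And>i j. \<lbrakk>i \<in> {1..n}; j \<in> {1..n}; i \<noteq> j\<rbrakk> \<Longrightarrow> x0 i \<noteq> x0 j"
  shows "\<exists>x. point_vortex_solution n m {0..} x \<and> (\<forall>i\<in>{1..n}. x 0 i = x0 i)"
proof -
  have "\<forall>k. \<exists>x. point_vortex_solution n m {0..real k} x \<and> (\<forall>i\<in>{1..n}. x 0 i = x0 i)"
    using point_vortex_solution_on_interval[OF inj] by simp
  then obtain X where X: "\<And>k. point_vortex_solution n m {0..real k} (X k)"
    "\<And>k i. i \<in> {1..n} \<Longrightarrow> X k 0 i = x0 i" by metis
  \<comment> \<open>The index \<open>k\<close> chosen at time \<open>t\<close> satisfies \<open>t < k\<close>, so \<open>[0, k]\<close> is a neighbourhood of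
    \<open>t\<close> in the half-line and the derivative of \<open>X k\<close> is the one required.\<close>
  define x where "x = (\<lambda>t. X (Suc (nat \<lceil>t\<rceil>)) t)"
  have agree: "x t i = X k t i" if "0 \<le> t" "t \<le> real k" "i \<in> {1..n}" for t k i
  proof -
    have "t \<le> real (Suc (nat \<lceil>t\<rceil>))" using real_nat_ceiling_ge[of t] by simp
    then have "{0..t} \<subseteq> {0..real (Suc (nat \<lceil>t\<rceil>))}" "{0..t} \<subseteq> {0..real k}"
      using that by auto
    then have "point_vortex_solution n m {0..t} (X (Suc (nat \<lceil>t\<rceil>)))"
      "point_vortex_solution n m {0..t} (X k)"
      using point_vortex_solution_subset[OF X(1)] by blast+
    then have "X (Suc (nat \<lceil>t\<rceil>)) t i = X k t i"
      by (rule point_vortex_solution_unique) (use that X(2) in auto)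
    then show ?thesis by (simp add: x_def)
  qed
  have "point_vortex_solution n m {0..} x"
    unfolding point_vortex_solution_def
  proof (intro ballI conjI impI)
    fix t :: real assume "t \<in> {0..}"
    define k where "k = Suc (nat \<lceil>t\<rceil>)"
    have "t < 1 + real (nat \<lceil>t\<rceil>)" using real_nat_ceiling_ge[of t] by linarith
    then have t: "0 \<le> t" "t < real k" using \<open>t \<in> {0..}\<close> by (simp_all add: k_def)
    have xt: "x t = X k t" by (simp add: x_def k_def)
    show "x t i \<noteq> x t j" if "i \<in> {1..n}" "j \<in> {1..n}" "i \<noteq> j" for i j
      using X(1)[of k] t that by (auto simp: point_vortex_solution_def xt)
    fix i assume i: "i \<in> {1..n}"
    have "((\<lambda>s. X k s i) has_vector_derivative
        (\<Sum>j\<in>{1..n} - {i}. m j *\<^sub>R vortex_kernel (x t i) (x t j))) (at t within {0..real k})"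
      using X(1)[of k] t i by (auto simp: point_vortex_solution_def xt)
    then have "((\<lambda>s. x s i) has_vector_derivative
        (\<Sum>j\<in>{1..n} - {i}. m j *\<^sub>R vortex_kernel (x t i) (x t j))) (at t within {0..real k})"
      by (rule has_vector_derivative_transform[rotated -1]) (use t i agree in auto)
    moreover have "at t within {0..real k} = at t within {0..}"
      by (rule at_within_nhd[of _ "{..<real k}"]) (use t in auto)
    ultimately show "((\<lambda>s. x s i) has_vector_derivative
        (\<Sum>j\<in>{1..n} - {i}. m j *\<^sub>R vortex_kernel (x t i) (x t j))) (at t within {0..})"
      by simp
  qed
  moreover have "\<forall>i\<in>{1..n}. x 0 i = x0 i" using X(2) by (simp add: x_def)
  ultimately show ?thesis by blast
qed

end

theorem theorem7:
  fixes n :: nat and m :: "nat \<Rightarrow> real" and x0 :: "nat \<Rightarrow> real^2"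
  assumes "n \<ge> 1"
    and "\<And>i. i \<in> {2..n} \<Longrightarrow> m i > 0"
    and "m 1 < 0"
    and "- m 1 > (\<Sum>i = 2..n. m i)"
    and "\<And>i j. i \<in> {1..n} \<Longrightarrow> j \<in> {1..n} \<Longrightarrow> i \<noteq> j \<Longrightarrow> x0 i \<noteq> x0 j"
  shows "\<exists>x. point_vortex_solution n m {0..} x \<and>
             (\<forall>i\<in>{1..n}. x 0 i = x0 i) \<and>
             (\<forall>J y. is_interval J \<and> 0 \<in> J \<and> J \<subseteq> {0..} \<and>
                point_vortex_solution n m J y \<and> (\<forall>i\<in>{1..n}. y 0 i = x0 i) \<longrightarrow>
                (\<forall>t\<in>J. \<forall>i\<in>{1..n}. y t i = x t i)) \<and>
             bdd_above ((\<lambda>t. MAX i\<in>{1..n}. norm (x t i)) ` {0..})"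
proof -
  interpret dominant_negative_vortex n m
    by unfold_locales (use assms(1-4) in auto)
  obtain x where x: "point_vortex_solution n m {0..} x" "\<forall>i\<in>{1..n}. x 0 i = x0 i"
    using point_vortex_solution_global[of x0] assms(5) by blast
  have "y t i = x t i"
    if J: "is_interval J" "0 \<in> J" "J \<subseteq> {0..}" and y: "point_vortex_solution n m J y"
      "\<forall>i\<in>{1..n}. y 0 i = x0 i" and t: "t \<in> J" and i: "i \<in> {1..n}" for J y t i
  proof -
    have "{0..t} \<subseteq> J" using J(1,2) t mem_is_interval_1_I[of J 0 t] by auto
    then have "point_vortex_solution n m {0..t} y" by (rule point_vortex_solution_subset[OF y(1)])
    moreover have "point_vortex_solution n m {0..t} x"
      by (rule point_vortex_solution_subset[OF x(1)]) auto
    ultimately show ?thesis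
      by (rule point_vortex_solution_unique) (use x(2) y(2) i t J(3) in auto)
  qed
  moreover have "bdd_above ((\<lambda>t. MAX i\<in>{1..n}. norm (x t i)) ` {0..})"
  proof -
    obtain R where R: "\<And>e T x t i. \<lbrakk>blob_solution n m e {0..T} x; \<forall>i\<in>{1..n}. x 0 i = x0 i;
       t \<in> {0..T}; i \<in> {1..n}\<rbrakk> \<Longrightarrow> norm (x t i) \<le> R"
      using uniform_bound[of x0] by blast
    have "blob_solution n m 0 {0..t} x" for t
      by (rule point_vortex_solution_blob_0, rule point_vortex_solution_subset[OF x(1)]) auto
    then have "norm (x t i) \<le> R" if "t \<ge> 0" "i \<in> {1..n}" for t i
      using R[of 0 t x t i] x(2) that by simp
    then have "(MAX i\<in>{1..n}. norm (x t i)) \<le> R" if "t \<ge> 0" for t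
      using that \<open>n \<ge> 1\<close> by (subst Max_le_iff) auto
    then show ?thesis by (intro bdd_aboveI[of _ R]) auto
  qed
  ultimately show ?thesis using x by blast
qed

end
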